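(* Let $n\ge 1$, $d\ge 1$ and $m$ be integers, let $A\in\mathbb{R}^{m\times d}$ be a matrix of full column rank, no row of which is a positive multiple of another row, and let $b^0,b^1,\ldots,b^n\in\mathbb{R}^m$. For $i\in N_0$ let $\mathcal{P}_i:=\{x\in\mathbb{R}^d : Ax\le b^i\}$, and suppose each $\mathcal{P}_i$ is a full-dimensional polytope. Suppose that for every $j\in\{1,\ldots,m\}$, the inequality $A_{j\cdot}x\le b^i_j$ describes a nonempty face of $\mathcal{P}_i$ for every $i\in N_0$, and a facet of $\mathcal{P}_i$ for some $i\in N_0$. Suppose further that for every basic partition $\tau,\eta$ of the row indices of $A$: if $A_{\eta\cdot}A_{\tau\cdot}^{-1}b^i_\tau\le b^i_\eta$ holds for some $i\in N_0$, then it holds for every $i\in N_0$. Then the full optimal big-M lifting inequalities $$Ax+\sum_{i\in N}(b^0-b^i)z_i\le b^0,$$ together with $\sum_{j\in N}z_j\le 1$ and $z_j\ge 0$ for $j\in N$, give a minimal inequality description of $\mathcal{D}$ (that is, the solution set of this system in $\mathbb{R}^{d+n}$ is $\mathcal{D}$, and no inequality of the system can be removed without changing the solution set).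
   Context: Write $N=\{1,\ldots,n\}$ and $N_0=\{0,1,\ldots,n\}$. $\mathbf{e}_i$ denotes the $i$-th standard unit vector of $\mathbb{R}^n$ for $i\in N$, and $\mathbf{e}_0$ denotes the zero vector of $\mathbb{R}^n$. Points of $\mathbb{R}^{d+n}$ are written $\begin{pmatrix}x\\ z\end{pmatrix}$ with $x\in\mathbb{R}^d$, $z\in\mathbb{R}^n$. The polytope $\mathcal{D}$ is $$\mathcal{D}:=\operatorname{conv}\left(\bigcup_{i\in N_0}\left\{\begin{pmatrix}x\\ \mathbf{e}_i\end{pmatrix} : x\in\mathcal{P}_i\right\}\right)\subset\mathbb{R}^{d+n}.$$ $A_{j\cdot}$ denotes the $j$-th row of $A$, and for an ordered set $\sigma$ of row indices, $A_{\sigma\cdot}$ (resp. $b_\sigma$) denotes the submatrix of rows (resp. subvector of entries) indexed by $\sigma$. A basic partition of the row indices of $A$ is a pair of ordered sets $\tau=(\tau_1,\ldots,\tau_d)$, $\eta=(\eta_1,\ldots,\eta_{m-d})$ such that every element of $\{1,\ldots,m\}$ is in precisely one position of these two ordered sets, and $A_{\tau\cdot}$ is invertible. The face described by an inequality valid for a polytope is the set of points of the polytope satisfying it with equality; a facet is a face of dimension one less than that of the polytope. Full optimal big-M lifting: let $\alpha^\top x\le\beta$ be valid for $\mathcal{P}_k$, $k\in N_0$, and for $i\in N_0\setminus\{k\}$ put $M_i:=\min\{\beta-\alpha^\top x : x\in\mathcal{P}_i\}$. If $k=0$, the full optimal big-M lifting of $\alpha^\top x\le\beta$ is $\alpha^\top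 x+\sum_{i\in N}M_iz_i\le\beta$. If $k\in N$, it is $\alpha^\top x+\sum_{i\in N\setminus\{k\}}(M_i-M_0)z_i-M_0z_k\le\beta-M_0$. *)

theory Defs
  imports "HOL-Analysis.Analysis"
begin

text \<open>
  The index set \<open>N\<^sub>0 = {0, 1, \<dots>, n}\<close> is \<open>'n option\<close>: \<open>None\<close> is the index 0 and \<open>Some i\<close>
  the index \<open>i \<in> N\<close>.  The space of points \<open>(x, z)\<close> is \<open>(real^'d) \<times> (real^'n)\<close>.
\<close>

definition ineq_polyhedron :: "real^'d^'m \<Rightarrow> real^'m \<Rightarrow> (real^'d) set" where
  "ineq_polyhedron A \<beta> = {x. A *v x \<le> \<beta>}"

definition described_face :: "(real^'d) set \<Rightarrow> real^'d \<Rightarrow> real \<Rightarrow> (real^'d) set" where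
  "described_face P \<alpha> \<beta> = {x \<in> P. \<alpha> \<bullet> x = \<beta>}"

fun unit_vec0 :: "'n option \<Rightarrow> real^'n" where
  "unit_vec0 None = 0"
| "unit_vec0 (Some i) = axis i 1"

definition union_hull :: "('n option \<Rightarrow> (real^'d) set) \<Rightarrow> ((real^'d) \<times> (real^'n)) set" where
  "union_hull P = convex hull (\<Union>i. {(x, unit_vec0 i) |x. x \<in> P i})"


definition row_submatrix :: "real^'d^'m \<Rightarrow> ('d \<Rightarrow> 'm) \<Rightarrow> real^'d^'d" where
  "row_submatrix A \<tau> = (\<chi> k. A $ \<tau> k)"

definition subvector :: "real^'m \<Rightarrow> ('d \<Rightarrow> 'm) \<Rightarrow> real^'d" where
  "subvector \<beta> \<tau> = (\<chi> k. \<beta> $ \<tau> k)"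

text \<open>
  The ordered set \<open>\<tau>\<close> has its \<open>d\<close> positions indexed by \<open>'d\<close>, so that \<open>row_submatrix A \<tau>\<close> is a
  square matrix; \<open>\<eta>\<close> is the list of the remaining row indices.
\<close>

definition basic_partition :: "real^'d^'m \<Rightarrow> ('d \<Rightarrow> 'm) \<Rightarrow> 'm list \<Rightarrow> bool" where
  "basic_partition A \<tau> \<eta> \<longleftrightarrow>
     length \<eta> = CARD('m) - CARD('d) \<and>
     inj \<tau> \<and> distinct \<eta> \<and> range \<tau> \<inter> set \<eta> = {} \<and> range \<tau> \<union> set \<eta> = UNIV \<and>
     invertible (row_submatrix A \<tau>)"

text \<open>The inequality \<open>A\<^sub>\<eta> A\<^sub>\<tau>\<^sup>-\<^sup>1 \<beta>\<^sub>\<tau> \<le> \<beta>\<^sub>\<eta>\<close>, written out entry by entry.\<close>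

definition basic_feasible ::
    "real^'d^'m \<Rightarrow> real^'m \<Rightarrow> ('d \<Rightarrow> 'm) \<Rightarrow> 'm list \<Rightarrow> bool" where
  "basic_feasible A \<beta> \<tau> \<eta> \<longleftrightarrow>
     (\<forall>l < length \<eta>.
        A $ (\<eta> ! l) \<bullet> (matrix_inv (row_submatrix A \<tau>) *v subvector \<beta> \<tau>) \<le> \<beta> $ (\<eta> ! l))"


text \<open>A linear inequality \<open>a \<bullet> v \<le> c\<close> is represented by its data \<open>(a, c)\<close>.\<close>

type_synonym 'v inequality = "'v \<times> real"

definition solution_set :: "'i set \<Rightarrow> ('i \<Rightarrow> 'v::real_inner inequality) \<Rightarrow> 'v set" where
  "solution_set I sys = {v. \<forall>i\<in>I. fst (sys i) \<bullet> v \<le> snd (sys i)}"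

definition minimal_description :: "('i \<Rightarrow> 'v::real_inner inequality) \<Rightarrow> 'v set \<Rightarrow> bool" where
  "minimal_description sys S \<longleftrightarrow>
     solution_set UNIV sys = S \<and>
     (\<forall>i. solution_set (UNIV - {i}) sys \<noteq> solution_set UNIV sys)"


text \<open>
  \<open>big_M P \<alpha> \<beta> i\<close> is \<open>min {\<beta> - \<alpha> \<bullet> x | x \<in> P i}\<close>.  It is unspecified if the minimum does not
  exist, which cannot happen for nonempty polytopes.
\<close>

definition big_M ::
    "('n option \<Rightarrow> (real^'d) set) \<Rightarrow> real^'d \<Rightarrow> real \<Rightarrow> 'n option \<Rightarrow> real" where
  "big_M P \<alpha> \<beta> i = (LEAST M. M \<in> (\<lambda>x. \<beta> - \<alpha> \<bullet> x) ` P i)"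

text \<open>
  The full optimal big-M lifting of the inequality \<open>\<alpha> \<bullet> x \<le> \<beta>\<close>, assumed valid for \<open>P k\<close>.
\<close>

fun full_bigM_lifting ::
    "('n option \<Rightarrow> (real^'d) set) \<Rightarrow> 'n option \<Rightarrow> real^'d \<Rightarrow> real
      \<Rightarrow> ((real^'d) \<times> (real^'n)) inequality" where
  "full_bigM_lifting P None \<alpha> \<beta> = ((\<alpha>, \<chi> i. big_M P \<alpha> \<beta> (Some i)), \<beta>)"
| "full_bigM_lifting P (Some k) \<alpha> \<beta> =
     ((\<alpha>, \<chi> i. if i = k then - big_M P \<alpha> \<beta> None
               else big_M P \<alpha> \<beta> (Some i) - big_M P \<alpha> \<beta> None),
      \<beta> - big_M P \<alpha> \<beta> None)"


datatype ('m, 'n) system_index = Row 'm | Sum_Le_One | Nonneg 'n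

fun lifted_system ::
    "real^'d^'m \<Rightarrow> ('n option \<Rightarrow> real^'m) \<Rightarrow> ('m, 'n) system_index
      \<Rightarrow> ((real^'d) \<times> (real^'n)) inequality" where
  "lifted_system A b (Row j) = ((A $ j, \<chi> i. (b None - b (Some i)) $ j), b None $ j)"
| "lifted_system A b Sum_Le_One = ((0, \<chi> i. 1), 1)"
| "lifted_system A b (Nonneg i) = ((0, - axis i 1), 0)"

lemma solution_set_lifted_system:
  fixes A :: "real^'d^'m" and b :: "'n::finite option \<Rightarrow> real^'m"
  shows "solution_set UNIV (lifted_system A b) =
    {(x, z). A *v x + (\<Sum>i\<in>UNIV. z $ i *\<^sub>R (b None - b (Some i))) \<le> b None \<and>
             (\<Sum>i\<in>UNIV. z $ i) \<le> 1 \<and> (\<forall>i. z $ i \<ge> 0)}"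
proof -
  have all_index: "(\<forall>s. Q s) \<longleftrightarrow> (\<forall>j. Q (Row j)) \<and> Q Sum_Le_One \<and> (\<forall>i. Q (Nonneg i))"
    for Q :: "('m, 'n) system_index \<Rightarrow> bool"
    by (metis system_index.exhaust)
  have "v \<in> solution_set UNIV (lifted_system A b) \<longleftrightarrow>
      A *v fst v + (\<Sum>i\<in>UNIV. snd v $ i *\<^sub>R (b None - b (Some i))) \<le> b None \<and>
      (\<Sum>i\<in>UNIV. snd v $ i) \<le> 1 \<and> (\<forall>i. snd v $ i \<ge> 0)" for v
    by (cases v) (simp add: solution_set_def all_index less_eq_vec_def matrix_vector_mul_component
      inner_vec_def[of "vec_lambda _"] inner_axis' mult.commute)
  then show ?thesis
    by auto
qed

end

theory Submission
  imports Defs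
begin

text \<open>
  Write \<open>P\<^sub>i\<close> for the polytope \<open>A x \<le> b\<^sub>i\<close>.  Every row is tight somewhere on every \<open>P\<^sub>i\<close>, so the
  maximum of \<open>A\<^sub>j x\<close> over \<open>P\<^sub>i\<close> is \<open>b\<^sub>i\<^sub>j\<close> and the big-M constants are differences of right-hand
  sides: whichever polytope a row is lifted from, the result is the same.

  At the point \<open>(x, e\<^sub>i)\<close> the lifted system says exactly \<open>x \<in> P\<^sub>i\<close>; hence its solution set, being
  convex, contains the hull.  For the other inclusion read a solution \<open>(x, z)\<close> as convex weights
  \<open>l\<close> on the indices (the slack of \<open>\<Sum>\<^sub>i z\<^sub>i \<le> 1\<close> being the weight of index 0) together with
  \<open>A x \<le> \<Sum>\<^sub>i l\<^sub>i b\<^sub>i\<close>.  The point to be shown is that \<open>x\<close> then lies in \<open>\<Sum>\<^sub>i l\<^sub>i P\<^sub>i\<close>.  The hypothesis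
  on basic partitions does not directly say that a basis feasible for the mixed right-hand side
  \<open>\<Sum>\<^sub>i l\<^sub>i b\<^sub>i\<close> is feasible for any single \<open>b\<^sub>i\<close>, so vertices of the mixed polytope are avoided and
  linear programming duality is used instead.  Maximise an objective \<open>c\<close> over one \<open>P\<^sub>i\<close>: there is a
  basis \<open>\<tau>\<close> that is feasible there and has \<open>c\<close> in the cone of its rows (\<open>ex_optimal_basis\<close>).  By
  hypothesis \<open>\<tau>\<close> is feasible for all right-hand sides, so its basic solutions \<open>u\<^sub>i\<close> lie in the \<open>P\<^sub>i\<close>;
  and the same nonnegative multipliers bound \<open>c x\<close> by \<open>c (\<Sum>\<^sub>i l\<^sub>i u\<^sub>i)\<close>.  Thus no hyperplane
  separates \<open>(x, z)\<close> from the hull (\<open>solution_set_subset_union_hull\<close>).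

  An inequality cannot be dropped if some solution makes it tight and a direction leaves its
  halfspace while respecting all other tight inequalities (\<open>solution_set_remove_neq\<close>).  For
  \<open>z\<^sub>i \<ge> 0\<close> and \<open>\<Sum>\<^sub>i z\<^sub>i \<le> 1\<close> the solution is an interior point of some \<open>P\<^sub>k\<close> placed over \<open>e\<^sub>k\<close>.  For
  row \<open>j\<close> it is a point of a facet that the row describes: since no row is a positive multiple of
  another, a relative interior point of the facet makes no other row tight (\<open>ex_facet_point\<close>).
\<close>

section \<open>Finitely generated cones\<close>

lemma convex_cone_hull_finite:
  assumes "finite S" "c \<in> convex_cone hull S"
  obtains y where "\<And>s. s \<in> S \<Longrightarrow> 0 \<le> y s" "c = (\<Sum>s\<in>S. y s *\<^sub>R s)"
proof -
  let ?K = "{c. \<exists>y. (\<forall>s\<in>S. 0 \<le> y s) \<and> c = (\<Sum>s\<in>S. y s *\<^sub>R s)}"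
  have "S \<subseteq> ?K"
  proof
    fix s assume "s \<in> S"
    then have "s = (\<Sum>t\<in>S. (if t = s then 1 else 0) *\<^sub>R t)"
      using \<open>finite S\<close> by (simp add: if_distrib[of "\<lambda>u. u *\<^sub>R _"] cong: if_cong)
    then show "s \<in> ?K"
      by (intro CollectI exI[of _ "\<lambda>t. if t = s then 1 else 0"]) auto
  qed
  moreover have "convex_cone ?K"
    unfolding convex_cone_iff
  proof (intro conjI ballI allI impI)
    show "0 \<in> ?K"
      by (auto intro!: exI[of _ "\<lambda>_. 0"])
  next
    fix c d assume "c \<in> ?K" "d \<in> ?K"
    then obtain y u where "\<forall>s\<in>S. 0 \<le> y s" "c = (\<Sum>s\<in>S. y s *\<^sub>R s)"
        "\<forall>s\<in>S. 0 \<le> u s" "d = (\<Sum>s\<in>S. u s *\<^sub>R s)"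
      by blast
    then show "c + d \<in> ?K"
      by (intro CollectI exI[of _ "\<lambda>s. y s + u s"]) (simp add: scaleR_add_left sum.distrib)
  next
    fix c and r :: real assume "c \<in> ?K" "0 \<le> r"
    then obtain y where "\<forall>s\<in>S. 0 \<le> y s" "c = (\<Sum>s\<in>S. y s *\<^sub>R s)"
      by blast
    with \<open>0 \<le> r\<close> show "r *\<^sub>R c \<in> ?K"
      by (intro CollectI exI[of _ "\<lambda>s. r * y s"]) (simp add: scaleR_sum_right)
  qed
  ultimately have "convex_cone hull S \<subseteq> ?K"
    by (rule hull_minimal)
  with assms that show thesis
    by blast
qed

text \<open>
  A linear relation among the generators, normalised to have some positive coefficient, can be
  subtracted from the representation until a first coefficient vanishes; this removes a generator.
\<close>
lemma conic_Caratheodory: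
  fixes S :: "'a::real_vector set"
  assumes "finite S" "\<And>s. s \<in> S \<Longrightarrow> 0 \<le> y s" "c = (\<Sum>s\<in>S. y s *\<^sub>R s)"
  shows "\<exists>T u. T \<subseteq> S \<and> independent T \<and> (\<forall>s\<in>T. 0 \<le> u s) \<and> c = (\<Sum>s\<in>T. u s *\<^sub>R s)"
  using assms
proof (induction "card S" arbitrary: S y rule: less_induct)
  case less
  show ?case
  proof (cases "independent S")
    case True
    with less.prems show ?thesis
      by blast
  next
    case False
    then obtain \<mu>0 s0 where \<mu>0: "s0 \<in> S" "\<mu>0 s0 \<noteq> 0" "(\<Sum>s\<in>S. \<mu>0 s *\<^sub>R s) = 0"
      using dependent_finite[OF less.prems(1)] by auto
    \<comment> \<open>flipping the sign of the relation makes at least one coefficient positive\<close>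
    define \<mu> where "\<mu> s = sgn (\<mu>0 s0) * \<mu>0 s" for s
    have "\<mu> s0 > 0"
      using \<mu>0(2) by (simp add: \<mu>_def sgn_real_def)
    have \<mu>_sum: "(\<Sum>s\<in>S. \<mu> s *\<^sub>R s) = 0"
      using \<mu>0(3) by (simp add: \<mu>_def flip: scaleR_scaleR scaleR_sum_right)
    define Q where "Q = {s \<in> S. 0 < \<mu> s}"
    have Q: "finite Q" "Q \<noteq> {}"
      using less.prems(1) \<mu>0(1) \<open>\<mu> s0 > 0\<close> by (auto simp: Q_def)
    obtain q where q: "q \<in> Q" "\<And>s. s \<in> Q \<Longrightarrow> y q / \<mu> q \<le> y s / \<mu> s"
      using ex_is_arg_min_if_finite[OF Q, of "\<lambda>s. y s / \<mu> s"] unfolding is_arg_min_linorder by auto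
    have qS: "q \<in> S" "0 < \<mu> q"
      using q(1) by (auto simp: Q_def)
    \<comment> \<open>the largest multiple that can be subtracted while all coefficients stay nonnegative\<close>
    define t where "t = y q / \<mu> q"
    have "0 \<le> t"
      using less.prems(2)[OF qS(1)] qS(2) by (simp add: t_def)
    define u where "u s = y s - t * \<mu> s" for s
    have "u q = 0"
      using qS by (simp add: u_def t_def)
    have u_nonneg: "0 \<le> u s" if "s \<in> S" for s
    proof (cases "0 < \<mu> s")
      case True
      then have "t \<le> y s / \<mu> s"
        unfolding t_def using that by (intro q(2)) (simp add: Q_def)
      with True show ?thesis
        by (simp add: u_def field_simps)
    next
      case False
      then have "t * \<mu> s \<le> 0"
        using \<open>0 \<le> t\<close> by (simp add: mult_nonneg_nonpos)
      with less.prems(2)[OF that] show ?thesis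
        by (simp add: u_def)
    qed
    have "c = (\<Sum>s\<in>S. y s *\<^sub>R s) - t *\<^sub>R (\<Sum>s\<in>S. \<mu> s *\<^sub>R s)"
      using less.prems(3) \<mu>_sum by simp
    also have "\<dots> = (\<Sum>s\<in>S. u s *\<^sub>R s)"
      by (simp add: u_def scaleR_diff_left sum_subtractf scaleR_sum_right)
    also have "\<dots> = (\<Sum>s\<in>S - {q}. u s *\<^sub>R s)"
      using less.prems(1) qS(1) \<open>u q = 0\<close> by (simp add: sum.remove)
    finally have "c = (\<Sum>s\<in>S - {q}. u s *\<^sub>R s)" .
    moreover have "card (S - {q}) < card S"
      using less.prems(1) qS(1) by (intro psubset_card_mono) auto
    ultimately obtain T u' where "T \<subseteq> S - {q}" "independent T" "\<forall>s\<in>T. 0 \<le> u' s"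
        "c = (\<Sum>s\<in>T. u' s *\<^sub>R s)"
      using less.hyps[of "S - {q}" u] less.prems(1) u_nonneg by auto
    then show ?thesis
      by blast
  qed
qed

text \<open>
  The hull is closed, so a point outside it is strictly separated from it.  As the hull is a cone,
  the separating functional is bounded on it only if it has a sign there.
\<close>
lemma Farkas:
  fixes S :: "'a::euclidean_space set"
  assumes "finite S" and polar: "\<And>w. (\<And>s. s \<in> S \<Longrightarrow> s \<bullet> w \<le> 0) \<Longrightarrow> c \<bullet> w \<le> 0"
  shows "c \<in> convex_cone hull S"
proof (rule ccontr)
  let ?K = "convex_cone hull S"
  assume "c \<notin> ?K"
  then obtain a r where a: "a \<bullet> c < r" "\<And>x. x \<in> ?K \<Longrightarrow> r < a \<bullet> x"
    using separating_hyperplane_closed_point[OF convex_convex_cone_hull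
        closed_convex_cone_hull[OF assms(1)]] by metis
  have "r < 0"
    using a(2)[OF convex_cone_hull_contains_0] by simp
  have "s \<bullet> (- a) \<le> 0" if "s \<in> S" for s
  proof (rule ccontr)
    assume "\<not> s \<bullet> (- a) \<le> 0"
    then have neg: "a \<bullet> s < 0"
      by (simp add: inner_commute)
    \<comment> \<open>scaling the generator brings it onto the separating hyperplane\<close>
    have "(r / (a \<bullet> s)) *\<^sub>R s \<in> ?K"
      using that neg \<open>r < 0\<close> by (intro convex_cone_hull_mul hull_inc) (auto simp: divide_nonpos_neg)
    from a(2)[OF this] neg show False
      by simp
  qed
  from polar[OF this] a(1) \<open>r < 0\<close> show False
    by (simp add: inner_commute)
qed

section \<open>Feasible steps and extreme points of polyhedra\<close>

text \<open>
  Short steps keep strict inequalities by continuity and tight ones by the sign of the direction.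
  Phrasing this as an eventual property lets several step-length conditions be combined.
\<close>
lemma eventually_feasible_step:
  fixes a :: "'i \<Rightarrow> 'v::real_inner"
  assumes "finite J"
    and "\<And>j. j \<in> J \<Longrightarrow> a j \<bullet> x < r j \<or> a j \<bullet> x = r j \<and> a j \<bullet> w \<le> 0"
  shows "\<forall>\<^sub>F t in at_right 0. \<forall>j\<in>J. a j \<bullet> (x + t *\<^sub>R w) \<le> r j"
proof (intro eventually_ball_finite ballI assms(1))
  fix j assume "j \<in> J"
  then consider "a j \<bullet> x < r j" | "a j \<bullet> x = r j" "a j \<bullet> w \<le> 0"
    using assms(2) by blast
  then show "\<forall>\<^sub>F t in at_right 0. a j \<bullet> (x + t *\<^sub>R w) \<le> r j"
  proof cases
    case 1
    have "((\<lambda>t. a j \<bullet> (x + t *\<^sub>R w)) \<longlongrightarrow> a j \<bullet> (x + 0 *\<^sub>R w)) (at_right 0)"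
      by (intro tendsto_intros)
    from order_tendstoD(2)[OF this, of "r j"] 1 show ?thesis
      by (auto elim: eventually_mono)
  next
    case 2
    have "\<forall>\<^sub>F t::real in at_right 0. 0 < t"
      by (rule eventually_at_right_less)
    then show ?thesis
      by eventually_elim (use 2 in \<open>simp add: inner_add_right mult_nonneg_nonpos\<close>)
  qed
qed

lemma mem_ineq_polyhedron: "x \<in> ineq_polyhedron A \<beta> \<longleftrightarrow> (\<forall>j. A $ j \<bullet> x \<le> \<beta> $ j)"
  by (simp add: ineq_polyhedron_def less_eq_vec_def matrix_vector_mul_component)

lemma eventually_step_in_polyhedron:
  assumes "x \<in> ineq_polyhedron A \<beta>"
    and "\<And>j. A $ j \<bullet> x = \<beta> $ j \<Longrightarrow> A $ j \<bullet> w \<le> 0"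
  shows "\<forall>\<^sub>F t in at_right 0. x + t *\<^sub>R w \<in> ineq_polyhedron A \<beta>"
  using eventually_feasible_step[of UNIV "\<lambda>j. A $ j" x "\<lambda>j. \<beta> $ j" w] assms
  by (auto simp: mem_ineq_polyhedron order_less_le)

text \<open>
  Otherwise some \<open>w \<noteq> 0\<close> is orthogonal to all tight rows, and the point is the midpoint of two
  feasible points obtained by moving a little along \<open>w\<close> and along \<open>- w\<close>.
\<close>
lemma extreme_point_active_rows_span:
  assumes "x extreme_point_of ineq_polyhedron A \<beta>"
  shows "span {A $ j |j. A $ j \<bullet> x = \<beta> $ j} = UNIV"
proof (rule ccontr)
  assume "span {A $ j |j. A $ j \<bullet> x = \<beta> $ j} \<noteq> UNIV"
  then obtain w where "w \<noteq> 0" and orth: "\<And>v. v \<in> span {A $ j |j. A $ j \<bullet> x = \<beta> $ j} \<Longrightarrow> w \<bullet> v = 0"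
    using span_not_UNIV_orthogonal by blast
  have zero: "A $ j \<bullet> w = 0" if "A $ j \<bullet> x = \<beta> $ j" for j
  proof -
    have "A $ j \<in> {A $ j |j. A $ j \<bullet> x = \<beta> $ j}"
      using that by blast
    from orth[OF span_base[OF this]] show ?thesis
      by (simp add: inner_commute)
  qed
  have x: "x \<in> ineq_polyhedron A \<beta>"
    using assms by (simp add: extreme_point_of_def)
  have "\<forall>\<^sub>F t in at_right 0. x + t *\<^sub>R w \<in> ineq_polyhedron A \<beta> \<and>
      x + t *\<^sub>R (- w) \<in> ineq_polyhedron A \<beta> \<and> 0 < t"
    using zero by (intro eventually_conj eventually_step_in_polyhedron x eventually_at_right_less)
      auto
  then obtain t where t: "x + t *\<^sub>R w \<in> ineq_polyhedron A \<beta>" "x + t *\<^sub>R (- w) \<in> ineq_polyhedron A \<beta>"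
      "0 < t"
    using eventually_happens'[OF trivial_limit_at_right_real] by blast
  have "x = midpoint (x + t *\<^sub>R w) (x + t *\<^sub>R (- w))"
    using scaleR_2[of x] by (simp add: midpoint_def)
  moreover have "x + t *\<^sub>R w \<noteq> x + t *\<^sub>R (- w)"
  proof -
    have "(x + t *\<^sub>R w) - (x + t *\<^sub>R (- w)) = (2 * t) *\<^sub>R w"
      unfolding mult_2 scaleR_left_distrib by simp
    with \<open>w \<noteq> 0\<close> t(3) show ?thesis
      by auto
  qed
  ultimately have "x \<in> open_segment (x + t *\<^sub>R w) (x + t *\<^sub>R (- w))"
    by (metis midpoint_in_open_segment)
  with assms t show False
    by (auto simp: extreme_point_of_def)
qed

lemma ex_extreme_maximizer:
  fixes S :: "'a::euclidean_space set"
  assumes "compact S" "convex S" "S \<noteq> {}"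
  obtains x where "x extreme_point_of S" "\<And>y. y \<in> S \<Longrightarrow> c \<bullet> y \<le> c \<bullet> x"
proof -
  have "continuous_on S (\<lambda>x. c \<bullet> x)"
    by (intro continuous_intros)
  then obtain m where m: "m \<in> S" "\<And>y. y \<in> S \<Longrightarrow> c \<bullet> y \<le> c \<bullet> m"
    using continuous_attains_sup[OF assms(1,3)] by blast
  let ?F = "S \<inter> {x. c \<bullet> x = c \<bullet> m}"
  have F: "?F face_of S"
    using m assms(2) by (intro face_of_Int_supporting_hyperplane_le) auto
  have "compact ?F" "convex ?F" "?F \<noteq> {}"
    using assms m(1) by (auto intro: compact_Int_closed closed_hyperplane convex_Int convex_hyperplane)
  then obtain x where "x extreme_point_of ?F"
    using extreme_point_exists_convex by blast
  with F have "x extreme_point_of S" "c \<bullet> x = c \<bullet> m"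
    by (auto simp: extreme_point_of_face)
  with m that show thesis
    by auto
qed

section \<open>Optimal bases\<close>

lemma matrix_inv_inverse:
  fixes M :: "'a::semiring_1^'n^'m"
  assumes "invertible M"
  shows "M ** matrix_inv M = mat 1" "matrix_inv M ** M = mat 1"
  using someI_ex[OF assms[unfolded invertible_def]] by (simp_all add: matrix_inv_def)

text \<open>
  The fundamental theorem of linear programming, primal and dual side at once: the basis is
  feasible for \<open>\<beta>\<close>, and the \<open>y k\<close> are dual multipliers for the objective \<open>c\<close>.  Since the latter
  condition does not mention \<open>\<beta>\<close>, it survives a change of the right-hand side.

  Take an optimal extreme point.  By Farkas, \<open>c\<close> lies in the cone of the rows tight there, hence in
  the cone of linearly independent ones among them; these extend to a basis within the tight rows,
  which span the whole space.  Choosing the basis after the representation of \<open>c\<close> is what makes the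
  argument work at degenerate vertices.
\<close>
lemma ex_optimal_basis:
  fixes A :: "real^'d^'m" and \<beta> :: "real^'m" and c :: "real^'d"
  assumes "polytope (ineq_polyhedron A \<beta>)" "ineq_polyhedron A \<beta> \<noteq> {}"
  obtains \<tau> \<eta> y where "basic_partition A \<tau> \<eta>" "basic_feasible A \<beta> \<tau> \<eta>"
    "\<And>k. 0 \<le> y k" "c = (\<Sum>k\<in>UNIV. y k *\<^sub>R A $ \<tau> k)"
proof -
  let ?P = "ineq_polyhedron A \<beta>"
  obtain x where x: "x extreme_point_of ?P" "\<And>p. p \<in> ?P \<Longrightarrow> c \<bullet> p \<le> c \<bullet> x"
    using ex_extreme_maximizer assms polytope_imp_compact polytope_imp_convex by metis
  have xP: "x \<in> ?P"
    using x(1) by (simp add: extreme_point_of_def)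
  define R where "R = {A $ j |j. A $ j \<bullet> x = \<beta> $ j}"
  have "finite R"
    by (simp add: R_def)
  have "span R = UNIV"
    unfolding R_def using x(1) by (rule extreme_point_active_rows_span)
  have "c \<in> convex_cone hull R"
  proof (rule Farkas[OF \<open>finite R\<close>])
    fix w assume w: "\<And>s. s \<in> R \<Longrightarrow> s \<bullet> w \<le> 0"
    have "\<forall>\<^sub>F t in at_right 0. x + t *\<^sub>R w \<in> ?P \<and> 0 < t"
      using w by (intro eventually_conj eventually_step_in_polyhedron xP eventually_at_right_less)
        (auto simp: R_def)
    then obtain t where "x + t *\<^sub>R w \<in> ?P" "0 < t"
      using eventually_happens'[OF trivial_limit_at_right_real] by blast
    with x(2)[of "x + t *\<^sub>R w"] show "c \<bullet> w \<le> 0"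
      by (simp add: inner_add_right mult_le_0_iff)
  qed
  then obtain y where "\<And>s. s \<in> R \<Longrightarrow> 0 \<le> y s" "c = (\<Sum>s\<in>R. y s *\<^sub>R s)"
    using convex_cone_hull_finite[OF \<open>finite R\<close>] by metis
  then obtain T u where T: "T \<subseteq> R" "independent T" "\<forall>s\<in>T. 0 \<le> u s" "c = (\<Sum>s\<in>T. u s *\<^sub>R s)"
    using conic_Caratheodory[OF \<open>finite R\<close>, of y c] by blast
  obtain B where B: "T \<subseteq> B" "B \<subseteq> R" "independent B" "R \<subseteq> span B"
    using maximal_independent_subset_extend[OF T(1,2)] .
  have "finite B"
    using B(2) \<open>finite R\<close> finite_subset by blast
  have span_B: "span B = UNIV"
    using B(4) \<open>span R = UNIV\<close> by (metis span_mono span_span top.extremum_unique)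
  then have "card B = CARD('d)"
    using basis_card_eq_dim[of B UNIV] B(3) by simp
  then obtain g where g: "bij_betw g (UNIV :: 'd set) B"
    using finite_same_card_bij[OF finite_class.finite_UNIV \<open>finite B\<close>] by auto
  \<comment> \<open>the basis consists of vectors; the ordered set needs indices of tight rows realising them\<close>
  have "\<exists>j. A $ j = g k \<and> A $ j \<bullet> x = \<beta> $ j" for k
  proof -
    have "g k \<in> R"
      using bij_betwE[OF g] B(2) by blast
    then show ?thesis
      unfolding R_def by fastforce
  qed
  then obtain \<tau> where \<tau>: "\<And>k. A $ \<tau> k = g k" "\<And>k. A $ \<tau> k \<bullet> x = \<beta> $ \<tau> k"
    by metis
  have "inj \<tau>"
  proof (rule injI)
    fix k k' assume "\<tau> k = \<tau> k'"
    then have "g k = g k'"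
      using \<tau>(1) by metis
    with g show "k = k'"
      by (auto simp: bij_betw_def dest: injD)
  qed
  have "rows (row_submatrix A \<tau>) = B"
  proof -
    have "row k (row_submatrix A \<tau>) = g k" for k
      by (simp add: row_def row_submatrix_def \<tau>(1) vec_nth_inverse)
    then show ?thesis
      using g by (auto simp: rows_def bij_betw_def)
  qed
  then have inv: "invertible (row_submatrix A \<tau>)"
    using span_B by (simp add: invertible_left_inverse matrix_left_invertible_span_rows)
  obtain \<eta> where \<eta>: "set \<eta> = - range \<tau>" "distinct \<eta>"
    using finite_distinct_list[of "- range \<tau>"] by auto
  have "length \<eta> = CARD('m) - CARD('d)"
    using \<eta> \<open>inj \<tau>\<close> distinct_card[OF \<eta>(2)]
    by (simp add: Compl_eq_Diff_UNIV card_Diff_subset card_image)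
  then have "basic_partition A \<tau> \<eta>"
    using \<eta> \<open>inj \<tau>\<close> inv by (auto simp: basic_partition_def)
  moreover have "basic_feasible A \<beta> \<tau> \<eta>"
  proof -
    have "row_submatrix A \<tau> *v x = subvector \<beta> \<tau>"
      using \<tau>(2) by (simp add: vec_eq_iff matrix_vector_mul_component row_submatrix_def subvector_def)
    then have "matrix_inv (row_submatrix A \<tau>) *v subvector \<beta> \<tau> = x"
      using inv by (simp add: matrix_vector_mul_assoc matrix_inv_inverse flip: \<open>_ = subvector \<beta> \<tau>\<close>)
    with xP show ?thesis
      by (simp add: basic_feasible_def mem_ineq_polyhedron)
  qed
  moreover define y' where "y' k = (if g k \<in> T then u (g k) else 0)" for k
  moreover have "0 \<le> y' k" for k
    using T(3) by (simp add: y'_def)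
  moreover have "c = (\<Sum>k\<in>UNIV. y' k *\<^sub>R A $ \<tau> k)"
  proof -
    have "c = (\<Sum>s\<in>B. (if s \<in> T then u s else 0) *\<^sub>R s)"
      unfolding T(4) using B(1) \<open>finite B\<close> by (intro sum.mono_neutral_cong_left) auto
    also have "\<dots> = (\<Sum>k\<in>UNIV. y' k *\<^sub>R A $ \<tau> k)"
      using sum.reindex_bij_betw[OF g, symmetric] by (simp add: y'_def \<tau>(1))
    finally show ?thesis .
  qed
  ultimately show thesis
    using that by blast
qed

lemma basic_solution_in_polyhedron:
  assumes "basic_partition A \<tau> \<eta>" "basic_feasible A \<beta> \<tau> \<eta>"
  obtains v where "v \<in> ineq_polyhedron A \<beta>" "\<And>k. A $ \<tau> k \<bullet> v = \<beta> $ \<tau> k"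
proof -
  have inv: "invertible (row_submatrix A \<tau>)"
    using assms(1) unfolding basic_partition_def by blast
  define v where "v = matrix_inv (row_submatrix A \<tau>) *v subvector \<beta> \<tau>"
  have "row_submatrix A \<tau> *v v = subvector \<beta> \<tau>"
    using inv by (simp add: v_def matrix_vector_mul_assoc matrix_inv_inverse)
  then have tight: "A $ \<tau> k \<bullet> v = \<beta> $ \<tau> k" for k
    by (simp add: vec_eq_iff matrix_vector_mul_component row_submatrix_def subvector_def)
  have "A $ j \<bullet> v \<le> \<beta> $ j" for j
  proof (cases "j \<in> range \<tau>")
    case True
    with tight show ?thesis
      by auto
  next
    case False
    then have "j \<in> set \<eta>"
      using assms(1) unfolding basic_partition_def by blast
    then obtain l where "l < length \<eta>" "\<eta> ! l = j"
      by (auto simp: in_set_conv_nth)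
    with assms(2) show ?thesis
      unfolding basic_feasible_def v_def by blast
  qed
  then have "v \<in> ineq_polyhedron A \<beta>"
    by (simp add: mem_ineq_polyhedron)
  from this tight show thesis
    by (rule that)
qed

section \<open>The lifted system and the hull\<close>

lemma sum_UNIV_option:
  fixes f :: "'n::finite option \<Rightarrow> 'a::comm_monoid_add"
  shows "(\<Sum>i\<in>UNIV. f i) = f None + (\<Sum>i\<in>UNIV. f (Some i))"
  unfolding UNIV_option_conv by (subst sum.insert) (auto simp: sum.reindex)

lemma snd_lifted_system:
  "snd (lifted_system A b (Row j)) = b None $ j"
  "snd (lifted_system A b Sum_Le_One) = 1"
  "snd (lifted_system A b (Nonneg i)) = 0"
  by simp_all

text \<open>
  Over \<open>unit_vec0 k\<close> the correction term of a row shifts its right-hand side from \<open>b None\<close> to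
  \<open>b k\<close>.  Evaluating the other inequalities in the same form covers both the points and the
  directions used below, since directions too have a second component \<open>\<plusminus> unit_vec0 k\<close>.
\<close>
lemma lifted_system_at_unit_vec0:
  "fst (lifted_system A b (Row j)) \<bullet> (x, unit_vec0 k) = A $ j \<bullet> x + (b None $ j - b k $ j)"
  "fst (lifted_system A b Sum_Le_One) \<bullet> (x, unit_vec0 k) = (if k = None then 0 else 1)"
  "fst (lifted_system A b (Nonneg i)) \<bullet> (x, unit_vec0 k) = (if k = Some i then - 1 else 0)"
proof -
  show "fst (lifted_system A b (Row j)) \<bullet> (x, unit_vec0 k) = A $ j \<bullet> x + (b None $ j - b k $ j)"
    by (cases k) (simp_all add: inner_axis)
  show "fst (lifted_system A b Sum_Le_One) \<bullet> (x, unit_vec0 k) = (if k = None then 0 else 1)"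
    by (cases k) (simp_all add: inner_axis)
  show "fst (lifted_system A b (Nonneg i)) \<bullet> (x, unit_vec0 k) = (if k = Some i then - 1 else 0)"
    by (cases k) (auto simp: inner_axis_axis)
qed

lemma big_M_of_face:
  assumes "\<And>x. x \<in> P i \<Longrightarrow> \<alpha> \<bullet> x \<le> \<gamma>" and "described_face (P i) \<alpha> \<gamma> \<noteq> {}"
  shows "big_M P \<alpha> \<beta> i = \<beta> - \<gamma>"
  unfolding big_M_def
proof (rule Least_equality)
  show "\<beta> - \<gamma> \<in> (\<lambda>x. \<beta> - \<alpha> \<bullet> x) ` P i"
    using assms(2) by (auto simp: described_face_def)
next
  fix M assume "M \<in> (\<lambda>x. \<beta> - \<alpha> \<bullet> x) ` P i"
  with assms(1) show "\<beta> - \<gamma> \<le> M"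
    by force
qed

text \<open>
  Each row attains its right-hand side on every polytope, so the constant \<open>M\<^sub>i\<close> is
  \<open>b k $ j - b i $ j\<close>, and \<open>b k $ j\<close> cancels in the differences of constants that a lifting from
  \<open>k \<noteq> None\<close> uses; the exceptional coefficient of \<open>z\<^sub>k\<close> fits the pattern because \<open>M\<^sub>k = 0\<close>.
\<close>
lemma full_bigM_lifting_eq_Row:
  fixes A :: "real^'d^'m" and b :: "'n::finite option \<Rightarrow> real^'m"
  assumes "\<And>i. described_face (ineq_polyhedron A (b i)) (A $ j) (b i $ j) \<noteq> {}"
  shows "full_bigM_lifting (\<lambda>i. ineq_polyhedron A (b i)) k (A $ j) (b k $ j)
    = lifted_system A b (Row j)"
proof -
  have "big_M (\<lambda>i. ineq_polyhedron A (b i)) (A $ j) \<beta> i = \<beta> - b i $ j" for i \<beta>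
    using assms by (intro big_M_of_face) (auto simp: mem_ineq_polyhedron)
  then show ?thesis
    by (cases k) (auto simp: vec_eq_iff)
qed

lemma convex_solution_set: "convex (solution_set I sys)"
proof -
  have "solution_set I sys = (\<Inter>i\<in>I. {v. fst (sys i) \<bullet> v \<le> snd (sys i)})"
    by (auto simp: solution_set_def)
  then show ?thesis
    by (simp add: convex_INT convex_halfspace_le)
qed

lemma all_system_index:
  "(\<forall>s. Q s) \<longleftrightarrow> (\<forall>j. Q (Row j)) \<and> Q Sum_Le_One \<and> (\<forall>i. Q (Nonneg i))"
  by (metis (full_types) system_index.exhaust)

lemma union_hull_subset_solution_set:
  "union_hull (\<lambda>i. ineq_polyhedron A (b i)) \<subseteq> solution_set UNIV (lifted_system A b)"
  unfolding union_hull_def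
proof (rule hull_minimal)
  show "(\<Union>i. {(x, unit_vec0 i) |x. x \<in> ineq_polyhedron A (b i)})
      \<subseteq> solution_set UNIV (lifted_system A b)"
    by (auto simp: solution_set_def all_system_index lifted_system_at_unit_vec0 snd_lifted_system
        mem_ineq_polyhedron simp del: lifted_system.simps unit_vec0.simps)
qed (rule convex_solution_set)

lemma compact_union_hull:
  fixes P :: "'n::finite option \<Rightarrow> (real^'d) set"
  assumes "\<And>i. compact (P i)"
  shows "compact (union_hull P)"
proof -
  have "{(x, unit_vec0 i) |x. x \<in> P i} = P i \<times> {unit_vec0 i}" for i
    by auto
  then show ?thesis
    unfolding union_hull_def
    by (intro compact_convex_hull compact_UN) (auto intro: compact_Times assms)
qed

text \<open>
  Given a functional separating a solution from the hull, the basis optimal for its \<open>x\<close>-part is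
  feasible for all right-hand sides.  Its basic solutions, mixed with the weights read off from
  \<open>z\<close>, form a point of the hull with the same \<open>z\<close>-part that contradicts separation.
\<close>
lemma solution_set_subset_union_hull:
  fixes A :: "real^'d^'m" and b :: "'n::finite option \<Rightarrow> real^'m"
  assumes polytopes: "\<And>i. polytope (ineq_polyhedron A (b i))"
    and nonempty: "ineq_polyhedron A (b i0) \<noteq> {}"
    and bases: "\<And>\<tau> \<eta> i i'. \<lbrakk>basic_partition A \<tau> \<eta>; basic_feasible A (b i) \<tau> \<eta>\<rbrakk>
      \<Longrightarrow> basic_feasible A (b i') \<tau> \<eta>"
  shows "solution_set UNIV (lifted_system A b) \<subseteq> union_hull (\<lambda>i. ineq_polyhedron A (b i))"
proof
  let ?P = "\<lambda>i. ineq_polyhedron A (b i)"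
  fix v assume v: "v \<in> solution_set UNIV (lifted_system A b)"
  obtain x z where xz: "v = (x, z)"
    by (cases v)
  define l where "l i = (case i of None \<Rightarrow> 1 - (\<Sum>i\<in>UNIV. z $ i) | Some i \<Rightarrow> z $ i)" for i
  have l_nonneg: "0 \<le> l i" for i
    using v by (auto simp: solution_set_lifted_system xz l_def split: option.splits)
  have l_sum: "(\<Sum>i\<in>UNIV. l i) = 1"
    by (simp add: sum_UNIV_option l_def)
  have z_eq: "(\<Sum>i\<in>UNIV. l i *\<^sub>R unit_vec0 i) = z"
    using basis_expansion[of z] by (simp add: sum_UNIV_option l_def scalar_mult_eq_scaleR)
  have row: "A $ j \<bullet> x \<le> (\<Sum>i\<in>UNIV. l i * b i $ j)" for j
  proof -
    have "A $ j \<bullet> x + (\<Sum>i\<in>UNIV. z $ i * (b None $ j - b (Some i) $ j)) \<le> b None $ j"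
      using v by (auto simp: solution_set_lifted_system xz less_eq_vec_def matrix_vector_mul_component)
    then show ?thesis
      by (simp add: sum_UNIV_option l_def algebra_simps sum_subtractf sum_distrib_left)
  qed
  show "v \<in> union_hull ?P"
  proof (rule ccontr)
    assume notin: "v \<notin> union_hull ?P"
    have closed: "closed (union_hull ?P)"
      by (intro compact_imp_closed compact_union_hull polytope_imp_compact polytopes)
    have convex: "convex (union_hull ?P)"
      by (simp add: union_hull_def)
    obtain a r where a: "a \<bullet> v < r" "\<And>q. q \<in> union_hull ?P \<Longrightarrow> r < a \<bullet> q"
      using separating_hyperplane_closed_point[OF convex closed notin] by metis
    \<comment> \<open>the hull lies where \<open>a\<close> is large, so the objective to maximise is the negated \<open>x\<close>-part\<close>
    obtain c w where cw: "a = (- c, w)"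
      using that[of "- fst a" "snd a"] by simp
    obtain \<tau> \<eta> y where \<tau>: "basic_partition A \<tau> \<eta>" "basic_feasible A (b i0) \<tau> \<eta>"
        and y: "\<And>k. 0 \<le> y k" "c = (\<Sum>k\<in>UNIV. y k *\<^sub>R A $ \<tau> k)"
      using ex_optimal_basis[OF polytopes nonempty, of c] by blast
    have "\<exists>u. u \<in> ?P i \<and> (\<forall>k. A $ \<tau> k \<bullet> u = b i $ \<tau> k)" for i
      using basic_solution_in_polyhedron[OF \<tau>(1) bases[OF \<tau>]] by metis
    then obtain u where u: "\<And>i. u i \<in> ?P i" "\<And>i k. A $ \<tau> k \<bullet> u i = b i $ \<tau> k"
      by metis
    define q where "q = (\<Sum>i\<in>UNIV. l i *\<^sub>R (u i, unit_vec0 i :: real^'n))"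
    have "q \<in> union_hull ?P"
      unfolding q_def
    proof (rule convex_sum[OF _ convex l_sum])
      show "(u i, unit_vec0 i) \<in> union_hull ?P" for i
        unfolding union_hull_def using u(1) by (intro hull_inc) auto
    qed (auto simp: l_nonneg)
    have q: "q = (\<Sum>i\<in>UNIV. l i *\<^sub>R u i, z)"
      using z_eq by (simp add: q_def prod_eq_iff fst_sum snd_sum)
    have "c \<bullet> x = (\<Sum>k\<in>UNIV. y k * (A $ \<tau> k \<bullet> x))"
      by (simp add: y(2) inner_sum_left)
    also have "\<dots> \<le> (\<Sum>k\<in>UNIV. y k * (\<Sum>i\<in>UNIV. l i * b i $ \<tau> k))"
      by (intro sum_mono mult_left_mono row y(1))
    also have "\<dots> = c \<bullet> (\<Sum>i\<in>UNIV. l i *\<^sub>R u i)"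
      unfolding y(2) inner_sum_left by (simp add: inner_sum_right u(2) sum_distrib_left mult.left_commute)
    finally have "a \<bullet> q \<le> a \<bullet> v"
      by (simp add: cw q xz)
    with a(1) a(2)[OF \<open>q \<in> union_hull ?P\<close>] show False
      by simp
  qed
qed

section \<open>Irredundancy\<close>

text \<open>
  Moving a little along \<open>w\<close> from \<open>v\<close> violates inequality \<open>s\<close> and no other.
\<close>
lemma solution_set_remove_neq:
  fixes sys :: "'i \<Rightarrow> 'v::real_inner inequality"
  assumes "finite (UNIV :: 'i set)" "fst (sys s) \<bullet> v = snd (sys s)" "0 < fst (sys s) \<bullet> w"
    and others: "\<And>s'. s' \<noteq> s \<Longrightarrow> fst (sys s') \<bullet> v < snd (sys s') \<or>
      fst (sys s') \<bullet> v = snd (sys s') \<and> fst (sys s') \<bullet> w \<le> 0"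
  shows "solution_set (UNIV - {s}) sys \<noteq> solution_set UNIV sys"
proof -
  have "\<forall>\<^sub>F t in at_right 0. (\<forall>s'\<in>UNIV - {s}. fst (sys s') \<bullet> (v + t *\<^sub>R w) \<le> snd (sys s')) \<and> 0 < t"
    using assms(1) others
    by (intro eventually_conj eventually_feasible_step eventually_at_right_less)
      (auto intro: finite_subset)
  then obtain t where t: "\<forall>s'\<in>UNIV - {s}. fst (sys s') \<bullet> (v + t *\<^sub>R w) \<le> snd (sys s')" "0 < t"
    using eventually_happens'[OF trivial_limit_at_right_real] by blast
  then have "v + t *\<^sub>R w \<in> solution_set (UNIV - {s}) sys"
    by (simp add: solution_set_def)
  moreover have "v + t *\<^sub>R w \<notin> solution_set UNIV sys"
    using assms(2,3) t(2) by (auto simp: solution_set_def inner_add_right not_le intro!: exI[of _ s])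
  ultimately show ?thesis
    by blast
qed

lemma finite_system_index: "finite (UNIV :: ('m::finite, 'n::finite) system_index set)"
proof -
  have UNIV_eq: "UNIV = range Row \<union> {Sum_Le_One} \<union> range (Nonneg :: 'n \<Rightarrow> ('m, 'n) system_index)"
  proof (rule UNIV_eq_I)
    fix s :: "('m, 'n) system_index"
    show "s \<in> range Row \<union> {Sum_Le_One} \<union> range Nonneg"
      by (cases s) auto
  qed
  then show ?thesis
    by (simp only: UNIV_eq finite_Un finite_imageI finite_class.finite_UNIV finite.intros)
qed

lemma ex_strict_point:
  fixes A :: "real^'d^'m"
  assumes "aff_dim (ineq_polyhedron A \<beta>) = int CARD('d)" "\<And>j. A $ j \<noteq> 0"
  obtains x where "\<And>j. A $ j \<bullet> x < \<beta> $ j"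
proof -
  let ?P = "ineq_polyhedron A \<beta>"
  have P_eq: "?P = (\<Inter>j. {x. A $ j \<bullet> x \<le> \<beta> $ j})"
    by (auto simp: mem_ineq_polyhedron)
  have "convex ?P"
    unfolding P_eq by (intro convex_INT convex_halfspace_le)
  have "affine hull ?P = UNIV"
    using assms(1) by (simp flip: aff_dim_eq_full)
  then have "interior ?P = rel_interior ?P"
    by (simp add: rel_interior_interior)
  moreover have "?P \<noteq> {}"
    using assms(1) by auto
  ultimately have "interior ?P \<noteq> {}"
    using \<open>convex ?P\<close> by (simp add: rel_interior_eq_empty)
  then obtain x where x: "x \<in> interior ?P"
    by blast
  have "A $ j \<bullet> x < \<beta> $ j" for j
  proof -
    have "interior ?P \<subseteq> interior {x. A $ j \<bullet> x \<le> \<beta> $ j}"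
      by (intro interior_mono) (auto simp: P_eq)
    with x assms(2)[of j] show ?thesis
      by auto
  qed
  with that show thesis
    by blast
qed

text \<open>
  The component \<open>w\<close> of \<open>c\<close> orthogonal to \<open>a\<close> is a direction of the common hyperplane, so it is
  orthogonal to \<open>c\<close> as well and vanishes.
\<close>
lemma parallel_if_hyperplanes_eq:
  fixes a c :: "'a::real_inner"
  assumes "a \<noteq> 0" "{x. a \<bullet> x = r} = {x. c \<bullet> x = s}"
  shows "c = ((c \<bullet> a) / (a \<bullet> a)) *\<^sub>R a"
proof -
  define w where "w = c - ((c \<bullet> a) / (a \<bullet> a)) *\<^sub>R a"
  define x where "x = (r / (a \<bullet> a)) *\<^sub>R a"
  have aw: "a \<bullet> w = 0"
    using assms(1) by (simp add: w_def inner_diff_right inner_commute)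
  have ax: "a \<bullet> x = r"
    using assms(1) by (simp add: x_def)
  have "x \<in> {x. a \<bullet> x = r}" "x + w \<in> {x. a \<bullet> x = r}"
    using ax aw by (simp_all add: inner_add_right)
  then have "c \<bullet> x = s" "c \<bullet> (x + w) = s"
    unfolding assms(2) by simp_all
  then have "c \<bullet> w = 0"
    by (simp add: inner_add_right)
  then have "w \<bullet> w = 0"
    using aw by (simp add: w_def inner_diff_left)
  then show ?thesis
    by (simp add: w_def)
qed

text \<open>
  The witness is a relative interior point of the facet.  If another row were tight there, it would
  be tight on the whole facet, because it cuts out a face.  Both rows then describe the affine hull
  of the facet, so they are proportional, and comparison with a strictly feasible point shows that
  the factor is positive.
\<close>
lemma ex_facet_point:
  fixes A :: "real^'d^'m"
  assumes full: "aff_dim (ineq_polyhedron A \<beta>) = int CARD('d)"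
    and nonzero: "\<And>j. A $ j \<noteq> 0"
    and no_multiple: "\<And>j j' c. j \<noteq> j' \<Longrightarrow> 0 < c \<Longrightarrow> A $ j \<noteq> c *\<^sub>R A $ j'"
    and facet: "described_face (ineq_polyhedron A \<beta>) (A $ j) (\<beta> $ j) facet_of ineq_polyhedron A \<beta>"
  obtains x where "A $ j \<bullet> x = \<beta> $ j" "\<And>j'. j' \<noteq> j \<Longrightarrow> A $ j' \<bullet> x < \<beta> $ j'"
proof -
  let ?P = "ineq_polyhedron A \<beta>"
  define F where "F = described_face ?P (A $ j) (\<beta> $ j)"
  have F: "F facet_of ?P"
    using facet by (simp add: F_def)
  then have "F \<noteq> {}" "aff_dim F = int CARD('d) - 1" "convex F"
    using full by (auto simp: facet_of_def face_of_imp_convex)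
  then obtain x where x: "x \<in> rel_interior F"
    using rel_interior_eq_empty by blast
  have xP: "x \<in> ?P" and xj: "A $ j \<bullet> x = \<beta> $ j"
    using x rel_interior_subset by (auto simp: F_def described_face_def)
  obtain p where p: "\<And>i. A $ i \<bullet> p < \<beta> $ i"
    using ex_strict_point[OF full nonzero] by blast
  have "A $ k \<bullet> x \<noteq> \<beta> $ k" if "k \<noteq> j" for k
  proof
    assume tight: "A $ k \<bullet> x = \<beta> $ k"
    have in_hyperplane: "affine hull F = {x. A $ i \<bullet> x = \<beta> $ i}"
      if "F \<subseteq> {x. A $ i \<bullet> x = \<beta> $ i}" for i
    proof -
      have "affine hull F = affine hull {x. A $ i \<bullet> x = \<beta> $ i}"
        using aff_dim_eq_full_gen[OF that] \<open>aff_dim F = _\<close> nonzero[of i] by simp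
      then show ?thesis
        by (simp add: affine_hyperplane hull_same)
    qed
    have "F \<subseteq> {x. A $ k \<bullet> x = \<beta> $ k}"
    proof -
      have "(F \<inter> {x. A $ k \<bullet> x = \<beta> $ k}) face_of F"
        using \<open>convex F\<close>
        by (intro face_of_Int_supporting_hyperplane_le)
          (auto simp: F_def described_face_def mem_ineq_polyhedron)
      moreover have "x \<in> (F \<inter> {x. A $ k \<bullet> x = \<beta> $ k}) \<inter> rel_interior F"
        using x tight rel_interior_subset by auto
      ultimately show ?thesis
        using subset_of_face_of[of _ F F] by blast
    qed
    moreover have "F \<subseteq> {x. A $ j \<bullet> x = \<beta> $ j}"
      by (auto simp: F_def described_face_def)
    ultimately have "{x. A $ j \<bullet> x = \<beta> $ j} = {x. A $ k \<bullet> x = \<beta> $ k}"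
      using in_hyperplane by metis
    then obtain c where c: "A $ k = c *\<^sub>R A $ j"
      using parallel_if_hyperplanes_eq[OF nonzero] by metis
    have "c * (A $ j \<bullet> p) < c * (A $ j \<bullet> x)"
      using p[of k] tight by (simp add: c)
    moreover have "A $ j \<bullet> p < A $ j \<bullet> x"
      using p[of j] xj by simp
    ultimately have "0 < c"
      by (metis mult_left_mono_neg not_less order_less_imp_le)
    with c no_multiple that show False
      by blast
  qed
  with xP have "A $ k \<bullet> x < \<beta> $ k" if "k \<noteq> j" for k
    using that by (metis mem_ineq_polyhedron order_less_le)
  with xj that show thesis
    by blast
qed

theorem theorem15:
  fixes A :: "real^'d^'m" and b :: "'n::finite option \<Rightarrow> real^'m"
  assumes "rank A = CARD('d)"
    and "\<forall>j j'. j \<noteq> j' \<longrightarrow> \<not> (\<exists>c>0. A $ j = c *\<^sub>R A $ j')"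
    and "\<forall>i. polytope (ineq_polyhedron A (b i)) \<and>
             aff_dim (ineq_polyhedron A (b i)) = int CARD('d)"
    and "\<forall>j. (\<forall>i. described_face (ineq_polyhedron A (b i)) (A $ j) (b i $ j) \<noteq> {}) \<and>
             (\<exists>i. described_face (ineq_polyhedron A (b i)) (A $ j) (b i $ j)
                    facet_of ineq_polyhedron A (b i))"
    and "\<forall>\<tau> \<eta>. basic_partition A \<tau> \<eta> \<longrightarrow>
             (\<exists>i. basic_feasible A (b i) \<tau> \<eta>) \<longrightarrow> (\<forall>i. basic_feasible A (b i) \<tau> \<eta>)"
  shows "(\<forall>k j. full_bigM_lifting (\<lambda>i. ineq_polyhedron A (b i)) k (A $ j) (b k $ j)
                  = lifted_system A b (Row j)) \<and>
         minimal_description (lifted_system A b) (union_hull (\<lambda>i. ineq_polyhedron A (b i)))"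
proof (intro conjI allI)
  fix k j
  show "full_bigM_lifting (\<lambda>i. ineq_polyhedron A (b i)) k (A $ j) (b k $ j)
      = lifted_system A b (Row j)"
    using assms(4) by (intro full_bigM_lifting_eq_Row) blast
next
  let ?P = "\<lambda>i. ineq_polyhedron A (b i)"
  let ?sys = "lifted_system A b"
  have full: "aff_dim (?P i) = int CARD('d)" for i
    using assms(3) by blast
  have "?P None \<noteq> {}"
    using full[of None] by auto
  then have describes: "solution_set UNIV ?sys = union_hull ?P"
    using assms(3,5) by (intro equalityI union_hull_subset_solution_set
        solution_set_subset_union_hull) blast+
  have nonzero: "A $ j \<noteq> 0" for j
  proof
    \<comment> \<open>a zero row describes the whole polytope or the empty set, never a facet\<close>
    assume zero: "A $ j = 0"
    obtain i where "described_face (?P i) (A $ j) (b i $ j) facet_of ?P i"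
        "described_face (?P i) (A $ j) (b i $ j) \<noteq> {}"
      using assms(4) by blast
    moreover from this(2) have "described_face (?P i) (A $ j) (b i $ j) = ?P i"
      by (auto simp: described_face_def zero)
    ultimately show False
      by (simp add: facet_of_irrefl)
  qed
  have "\<exists>x. \<forall>j. A $ j \<bullet> x < b i $ j" for i
    using ex_strict_point[OF full nonzero] by metis
  then obtain x where x: "\<And>i j. A $ j \<bullet> x i < b i $ j"
    by metis
  note at = lifted_system_at_unit_vec0 snd_lifted_system
  have "solution_set (UNIV - {s}) ?sys \<noteq> solution_set UNIV ?sys" for s
  proof (cases s)
    case (Row j)
    obtain i where facet: "described_face (?P i) (A $ j) (b i $ j) facet_of ?P i"
      using assms(4) by blast
    obtain p where p: "A $ j \<bullet> p = b i $ j" "\<And>j'. j' \<noteq> j \<Longrightarrow> A $ j' \<bullet> p < b i $ j'"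
      using ex_facet_point[OF full nonzero _ facet] assms(2) by metis
    show ?thesis
      unfolding Row
    proof (rule solution_set_remove_neq)
      fix s' :: "('m, 'n) system_index" assume "s' \<noteq> Row j"
      then show "fst (?sys s') \<bullet> (p, unit_vec0 i) < snd (?sys s') \<or>
          fst (?sys s') \<bullet> (p, unit_vec0 i) = snd (?sys s') \<and>
          fst (?sys s') \<bullet> (A $ j, unit_vec0 None) \<le> 0"
        using p(2) by (cases s') (auto simp: at simp del: lifted_system.simps unit_vec0.simps)
    qed (use p nonzero in \<open>auto simp: finite_system_index at
        simp del: lifted_system.simps unit_vec0.simps\<close>)
  next
    case Sum_Le_One
    \<comment> \<open>the sum is tight over any \<open>e\<^sub>k\<close>, and growing \<open>z\<^sub>k\<close> leaves only its halfspace\<close>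
    fix k :: 'n
    show ?thesis
      unfolding Sum_Le_One
    proof (rule solution_set_remove_neq)
      fix s' :: "('m, 'n) system_index" assume "s' \<noteq> Sum_Le_One"
      then show "fst (?sys s') \<bullet> (x (Some k), unit_vec0 (Some k)) < snd (?sys s') \<or>
          fst (?sys s') \<bullet> (x (Some k), unit_vec0 (Some k)) = snd (?sys s') \<and>
          fst (?sys s') \<bullet> (0, unit_vec0 (Some k)) \<le> 0"
        using x[of _ "Some k"]
        by (cases s') (auto simp: at simp del: lifted_system.simps unit_vec0.simps)
    qed (auto simp: finite_system_index at simp del: lifted_system.simps unit_vec0.simps)
  next
    case (Nonneg i)
    \<comment> \<open>over the origin all nonnegativity constraints are tight, but only one of them sees \<open>z\<^sub>i\<close>\<close>
    show ?thesis
      unfolding Nonneg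
    proof (rule solution_set_remove_neq)
      fix s' :: "('m, 'n) system_index" assume "s' \<noteq> Nonneg i"
      then show "fst (?sys s') \<bullet> (x None, unit_vec0 None) < snd (?sys s') \<or>
          fst (?sys s') \<bullet> (x None, unit_vec0 None) = snd (?sys s') \<and>
          fst (?sys s') \<bullet> (- (0, unit_vec0 (Some i))) \<le> 0"
        unfolding inner_minus_right using x[of _ None]
        by (cases s') (auto simp: at simp del: lifted_system.simps unit_vec0.simps)
    qed (unfold inner_minus_right,
      auto simp: finite_system_index at simp del: lifted_system.simps unit_vec0.simps)
  qed
  with describes show "minimal_description ?sys (union_hull ?P)"
    by (simp add: minimal_description_def)
qed

end
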